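(* Let $n \geq 3$ and $m \geq 1$ be integers. The group $Q_{n,m}$ surjects onto a group that contains a subgroup isomorphic to the free Burnside group of exponent $m$ on $n-1$ generators.
   Context: $F_n$ is the free group with a fixed basis $\{a_1, \dots, a_n\}$. For $i \neq j$, $\lambda_{ij} \in \mathrm{Aut}(F_n)$ is the automorphism that sends $a_i$ to $a_j a_i$ and fixes $a_k$ for all $k \neq i$. $Q_{n,m}$ is the quotient of $\mathrm{Aut}(F_n)$ by the relations $\lambda_{ij}^m = 1$ for all $i \neq j$, i.e. the quotient by the normal closure of $\{\lambda_{ij}^m : i \neq j\}$. The free Burnside group of exponent $m$ on $r$ generators is the quotient of the free group $F_r$ by the subgroup generated by all $m$-th powers of its elements. *)

theory Defs
  imports "HOL-Algebra.Algebra"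
begin

(* A letter (x, True) stands for the generator x, and (x, False) for its inverse. *)
type_synonym 'a word = "('a \<times> bool) list"

definition words :: "'a set \<Rightarrow> 'a word set" where
  "words S = lists (S \<times> UNIV)"

inductive_set free_rel :: "'a set \<Rightarrow> ('a word \<times> 'a word) set" for S :: "'a set" where
  free_cancel: "u \<in> words S \<Longrightarrow> v \<in> words S \<Longrightarrow> x \<in> S \<Longrightarrow>
             (u @ [(x, b), (x, \<not> b)] @ v, u @ v) \<in> free_rel S"
| free_refl: "u \<in> words S \<Longrightarrow> (u, u) \<in> free_rel S"
| free_sym: "(u, v) \<in> free_rel S \<Longrightarrow> (v, u) \<in> free_rel S"
| free_trans: "(u, v) \<in> free_rel S \<Longrightarrow> (v, w) \<in> free_rel S \<Longrightarrow> (u, w) \<in> free_rel S"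

definition free_group :: "'a set \<Rightarrow> 'a word set monoid" where
  "free_group S =
     \<lparr>carrier = words S // free_rel S,
      monoid.mult = (\<lambda>A B. \<Union>u\<in>A. \<Union>v\<in>B. free_rel S `` {u @ v}),
      one = free_rel S `` {[]}\<rparr>"

definition basis_elem :: "'a set \<Rightarrow> 'a \<Rightarrow> 'a word set" where
  "basis_elem S x = free_rel S `` {[(x, True)]}"

type_synonym free_elem = "nat word set"
type_synonym free_aut = "free_elem \<Rightarrow> free_elem"

abbreviation Fn :: "nat \<Rightarrow> free_elem monoid" where
  "Fn n \<equiv> free_group {1..n}"

abbreviation gen :: "nat \<Rightarrow> nat \<Rightarrow> free_elem" where
  "gen n i \<equiv> basis_elem {1..n} i"

(* Elements of auto G are extensional, i.e. undefined outside the carrier; together with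
   the values on the basis this makes the described automorphism unique. *)
definition lam :: "nat \<Rightarrow> nat \<Rightarrow> nat \<Rightarrow> free_aut" where
  "lam n i j = (THE f. f \<in> auto (Fn n) \<and> f (gen n i) = gen n j \<otimes>\<^bsub>Fn n\<^esub> gen n i \<and>
                       (\<forall>k\<in>{1..n} - {i}. f (gen n k) = gen n k))"

definition normal_closure :: "('a, 'b) monoid_scheme \<Rightarrow> 'a set \<Rightarrow> 'a set" where
  "normal_closure G R = \<Inter>{N. N \<lhd> G \<and> R \<subseteq> N}"

definition Q_group :: "nat \<Rightarrow> nat \<Rightarrow> free_aut set monoid" where
  "Q_group n m = AutoGroup (Fn n) Mod
     normal_closure (AutoGroup (Fn n))
       {lam n i j [^]\<^bsub>AutoGroup (Fn n)\<^esub> m | i j. i \<in> {1..n} \<and> j \<in> {1..n} \<and> i \<noteq> j}"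

definition free_burnside :: "nat \<Rightarrow> nat \<Rightarrow> free_elem set monoid" where
  "free_burnside r m = Fn r Mod generate (Fn r) {x [^]\<^bsub>Fn r\<^esub> m | x. x \<in> carrier (Fn r)}"

end

theory Submission
  imports Defs
begin

text \<open>
  Let \<open>V\<close> be the subgroup of \<open>F\<^sub>n\<close> generated by all \<open>m\<close>-th powers, which every endomorphism
  preserves. The automorphisms of \<open>F\<^sub>n\<close> that induce the identity on \<open>F\<^sub>n / V\<close> form a
  normal subgroup \<open>K\<close>, and \<open>K\<close> contains \<open>\<lambda>\<^sub>i\<^sub>j\<^sup>m\<close>, which sends \<open>a\<^sub>i\<close> to \<open>a\<^sub>j\<^sup>m a\<^sub>i\<close>; so
  \<open>Q\<^sub>n\<^sub>,\<^sub>m\<close> surjects onto \<open>Aut(F\<^sub>n) / K\<close>. For a word \<open>w\<close> in the generators other than \<open>a\<^sub>n\<close>,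
  let \<open>\<tau> w\<close> send \<open>a\<^sub>n\<close> to \<open>w\<^sup>-\<^sup>1 a\<^sub>n\<close> and fix the other generators. This is a homomorphism
  \<open>\<tau>\<close> from \<open>F\<^sub>n\<^sub>-\<^sub>1\<close> to \<open>Aut(F\<^sub>n)\<close>, and \<open>\<tau> w\<close> lies in \<open>K\<close> iff \<open>w\<close> lies in \<open>V\<close>, which by the
  retraction of \<open>F\<^sub>n\<close> onto \<open>F\<^sub>n\<^sub>-\<^sub>1\<close> killing \<open>a\<^sub>n\<close> means that \<open>w\<close> is a product of \<open>m\<close>-th powers
  and their inverses in \<open>F\<^sub>n\<^sub>-\<^sub>1\<close>. Hence the image of \<open>\<tau>\<close> in \<open>Aut(F\<^sub>n) / K\<close> is the free
  Burnside group.
\<close>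

section \<open>Free groups\<close>

lemma words_Nil [simp]: "[] \<in> words S"
  by (simp add: words_def)

lemma words_Cons [simp]: "(x, b) # u \<in> words S \<longleftrightarrow> x \<in> S \<and> u \<in> words S"
  by (auto simp: words_def)

lemma words_append [simp]: "u @ v \<in> words S \<longleftrightarrow> u \<in> words S \<and> v \<in> words S"
  by (simp add: words_def)

lemma free_rel_words: "(u, v) \<in> free_rel S \<Longrightarrow> u \<in> words S \<and> v \<in> words S"
  by (induction rule: free_rel.induct) auto

lemma equiv_free_rel: "equiv (words S) (free_rel S)"
proof (rule equivI)
  show "free_rel S \<subseteq> words S \<times> words S"
    by (auto dest: free_rel_words)
  show "refl_on (words S) (free_rel S)"
    by (auto simp: refl_on_def intro: free_refl dest: free_rel_words)
  show "sym (free_rel S)"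
    by (rule symI) (rule free_sym)
  show "trans (free_rel S)"
    by (rule transI) (rule free_trans)
qed

text \<open>\<open>free_cancel\<close> already allows arbitrary words on both sides, so
  \<open>p\<close> and \<open>q\<close> are absorbed into them.\<close>

lemma free_rel_context:
  assumes "(u, v) \<in> free_rel S" "p \<in> words S" "q \<in> words S"
  shows "(p @ u @ q, p @ v @ q) \<in> free_rel S"
  using assms(1)
proof induction
  case (free_cancel u v x b)
  then show ?case
    using free_rel.free_cancel[of "p @ u" S "v @ q" x b] assms(2,3) by simp
next
  case (free_refl u)
  then show ?case using assms(2,3) by (auto intro: free_rel.free_refl)
qed (blast intro: free_sym free_trans)+

lemma free_rel_append:
  assumes "(u, u') \<in> free_rel S" "(v, v') \<in> free_rel S"
  shows "(u @ v, u' @ v') \<in> free_rel S"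
proof (rule free_trans)
  show "(u @ v, u' @ v) \<in> free_rel S"
    using free_rel_context[OF assms(1), of "[]" v] free_rel_words[OF assms(2)] by simp
  show "(u' @ v, u' @ v') \<in> free_rel S"
    using free_rel_context[OF assms(2), of u' "[]"] free_rel_words[OF assms(1)] by simp
qed

abbreviation word_class :: "'a set \<Rightarrow> 'a word \<Rightarrow> 'a word set" where
  "word_class S u \<equiv> free_rel S `` {u}"

lemma carrier_free_group: "carrier (free_group S) = word_class S ` words S"
  by (auto simp: free_group_def quotient_def)

lemma one_free_group: "\<one>\<^bsub>free_group S\<^esub> = word_class S []"
  by (simp add: free_group_def)

lemma word_class_eq: "(u, v) \<in> free_rel S \<Longrightarrow> word_class S u = word_class S v"
  using equiv_class_eq[OF equiv_free_rel] .

lemma mult_word_class: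
  assumes "u \<in> words S" "v \<in> words S"
  shows "word_class S u \<otimes>\<^bsub>free_group S\<^esub> word_class S v = word_class S (u @ v)"
proof -
  have "congruent2 (free_rel S) (free_rel S) (\<lambda>u v. word_class S (u @ v))"
    by (intro congruent2I' word_class_eq free_rel_append)
  then show ?thesis
    unfolding free_group_def
    using UN_equiv_class2[OF equiv_free_rel equiv_free_rel _ assms] by simp
qed

definition inv_word :: "'a word \<Rightarrow> 'a word" where
  "inv_word u = rev (map (\<lambda>(x, b). (x, \<not> b)) u)"

lemma inv_word_words [simp]: "u \<in> words S \<Longrightarrow> inv_word u \<in> words S"
  by (induction u) (auto simp: inv_word_def)

lemma inv_word_append_free_rel:
  "u \<in> words S \<Longrightarrow> (inv_word u @ u, []) \<in> free_rel S"
proof (induction u)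
  case Nil
  then show ?case by (simp add: inv_word_def free_refl)
next
  case (Cons a u)
  obtain x b where a: "a = (x, b)" by fastforce
  \<comment> \<open>The first letter and its inverse meet in the middle. The double negation lets
    \<open>free_cancel\<close> apply with \<open>\<not> b\<close> in place of its
    \<open>b\<close>.\<close>
  have "(inv_word u @ [(x, \<not> b), (x, \<not> \<not> b)] @ u, inv_word u @ u) \<in> free_rel S"
    using Cons.prems a by (intro free_cancel) auto
  moreover have "(inv_word u @ u, []) \<in> free_rel S"
    using Cons a by simp
  ultimately have "(inv_word u @ [(x, \<not> b), (x, \<not> \<not> b)] @ u, []) \<in> free_rel S"
    by (rule free_trans)
  then show ?case
    using a by (simp add: inv_word_def)
qed

lemma group_free_group: "group (free_group S)"
proof (rule groupI)
  fix x assume "x \<in> carrier (free_group S)"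
  then obtain u where "u \<in> words S" "x = word_class S u"
    by (auto simp: carrier_free_group)
  then show "\<exists>y\<in>carrier (free_group S). y \<otimes>\<^bsub>free_group S\<^esub> x = \<one>\<^bsub>free_group S\<^esub>"
    using inv_word_append_free_rel[of u S]
    by (auto simp: carrier_free_group mult_word_class one_free_group
             intro!: bexI[of _ "inv_word u"] word_class_eq)
qed (auto simp: carrier_free_group mult_word_class one_free_group)

lemma basis_elem_closed [simp]: "x \<in> S \<Longrightarrow> basis_elem S x \<in> carrier (free_group S)"
  by (auto simp: carrier_free_group basis_elem_def)

lemma word_class_letter_False:
  assumes "x \<in> S"
  shows "word_class S [(x, False)] = inv\<^bsub>free_group S\<^esub> basis_elem S x"
proof -
  interpret F: group "free_group S" by (rule group_free_group)
  have "([] @ [(x, False), (x, \<not> False)] @ [], [] @ []) \<in> free_rel S"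
    using assms by (intro free_cancel) auto
  then have "word_class S [(x, False)] \<otimes>\<^bsub>free_group S\<^esub> basis_elem S x = \<one>\<^bsub>free_group S\<^esub>"
    using assms by (auto simp: basis_elem_def mult_word_class one_free_group intro!: word_class_eq)
  then show ?thesis
    using assms by (intro F.inv_equality[symmetric] basis_elem_closed) (auto simp: carrier_free_group)
qed

section \<open>Evaluation of words and the universal property\<close>

fun word_eval :: "('a, 'c) monoid_scheme \<Rightarrow> ('b \<Rightarrow> 'a) \<Rightarrow> 'b word \<Rightarrow> 'a" where
  "word_eval G g [] = \<one>\<^bsub>G\<^esub>"
| "word_eval G g ((x, b) # u) = (if b then g x else inv\<^bsub>G\<^esub> g x) \<otimes>\<^bsub>G\<^esub> word_eval G g u"

context group
begin

lemma word_eval_closed: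
  "g \<in> S \<rightarrow> carrier G \<Longrightarrow> u \<in> words S \<Longrightarrow> word_eval G g u \<in> carrier G"
  by (induction u) (auto simp: Pi_iff)

lemma word_eval_append:
  assumes "g \<in> S \<rightarrow> carrier G" "u \<in> words S" "v \<in> words S"
  shows "word_eval G g (u @ v) = word_eval G g u \<otimes> word_eval G g v"
  using assms(2)
proof (induction u)
  case Nil
  then show ?case using word_eval_closed[OF assms(1,3)] by simp
next
  case (Cons a u)
  then show ?case
    using word_eval_closed[OF assms(1,3)] word_eval_closed[OF assms(1), of u] assms(1)
    by (cases a) (auto simp: m_assoc Pi_iff)
qed

lemma word_eval_free_rel:
  assumes "g \<in> S \<rightarrow> carrier G"
  shows "(u, v) \<in> free_rel S \<Longrightarrow> word_eval G g u = word_eval G g v"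
proof (induction rule: free_rel.induct)
  case (free_cancel u v x b)
  then have "g x \<in> carrier G" using assms by auto
  then have "word_eval G g ([(x, b), (x, \<not> b)] @ v) = word_eval G g v"
    using word_eval_closed[OF assms free_cancel(2)]
    by (cases b) (auto simp: m_assoc[symmetric])
  then show ?case
    using free_cancel by (simp add: word_eval_append[OF assms] del: append.simps)
qed auto

lemma free_group_universal:
  assumes "g \<in> S \<rightarrow> carrier G"
  obtains h where "h \<in> hom (free_group S) G" "\<And>x. x \<in> S \<Longrightarrow> h (basis_elem S x) = g x"
proof
  \<comment> \<open>Any representative serves, since evaluation is constant on classes by
    \<open>word_eval_free_rel\<close>.\<close>
  define h where "h A = word_eval G g (SOME u. u \<in> A)" for A
  have h: "h (word_class S u) = word_eval G g u" if "u \<in> words S" for u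
  proof -
    have "u \<in> word_class S u"
      using that by (simp add: free_refl)
    then have "(SOME v. v \<in> word_class S u) \<in> word_class S u"
      by (rule someI)
    then have "(u, SOME v. v \<in> word_class S u) \<in> free_rel S"
      by simp
    from word_eval_free_rel[OF assms this] show ?thesis
      unfolding h_def by simp
  qed
  show "h \<in> hom (free_group S) G"
    by (rule homI)
       (auto simp: carrier_free_group h mult_word_class word_eval_closed[OF assms]
         word_eval_append[OF assms])
  show "h (basis_elem S x) = g x" if "x \<in> S" for x
    using that assms by (auto simp: basis_elem_def h Pi_iff)
qed

text \<open>Every class is a product of letter classes, each a basis element or the inverse of one.
  Below, identities between homomorphisms are checked on the basis by this rule.\<close>

lemma free_group_hom_eqI:
  assumes "h \<in> hom (free_group S) G" "k \<in> hom (free_group S) G"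
    and eq: "\<And>x. x \<in> S \<Longrightarrow> h (basis_elem S x) = k (basis_elem S x)"
    and "A \<in> carrier (free_group S)"
  shows "h A = k A"
proof -
  interpret h: group_hom "free_group S" G h
    using assms(1) is_group group_free_group by (simp add: group_hom_def group_hom_axioms_def)
  interpret k: group_hom "free_group S" G k
    using assms(2) is_group group_free_group by (simp add: group_hom_def group_hom_axioms_def)
  have "h (word_class S u) = k (word_class S u)" if "u \<in> words S" for u
    using that
  proof (induction u)
    case Nil
    show ?case
      using h.hom_one k.hom_one by (simp add: one_free_group)
  next
    case (Cons a u)
    obtain x b where a: "a = (x, b)" by fastforce
    have letter: "h (word_class S [(x, b)]) = k (word_class S [(x, b)])"
      using Cons.prems a eq
      by (cases b) (auto simp: word_class_letter_False simp flip: basis_elem_def)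
    have "word_class S (a # u) = word_class S [(x, b)] \<otimes>\<^bsub>free_group S\<^esub> word_class S u"
      using Cons.prems a by (subst mult_word_class) auto
    then show ?case
      using Cons a letter by (simp add: carrier_free_group)
  qed
  then show ?thesis
    using assms(4) by (auto simp: carrier_free_group)
qed

end

text \<open>Membership in \<open>hom\<close> leaves values off the carrier open, so the extension is
  unique only on the carrier; hence \<open>SOME\<close>, not \<open>THE\<close>.\<close>

definition free_ext :: "('a, 'c) monoid_scheme \<Rightarrow> 'b set \<Rightarrow> ('b \<Rightarrow> 'a) \<Rightarrow> 'b word set \<Rightarrow> 'a" where
  "free_ext G S g =
     (SOME h. h \<in> hom (free_group S) G \<and> (\<forall>x\<in>S. h (basis_elem S x) = g x))"

lemma (in group) free_ext:
  assumes "g \<in> S \<rightarrow> carrier G"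
  shows free_ext_hom: "free_ext G S g \<in> hom (free_group S) G"
    and free_ext_basis: "x \<in> S \<Longrightarrow> free_ext G S g (basis_elem S x) = g x"
proof -
  have "\<exists>h. h \<in> hom (free_group S) G \<and> (\<forall>x\<in>S. h (basis_elem S x) = g x)"
    using free_group_universal[OF assms] by metis
  from someI_ex[OF this] show "free_ext G S g \<in> hom (free_group S) G"
    and "x \<in> S \<Longrightarrow> free_ext G S g (basis_elem S x) = g x"
    unfolding free_ext_def by blast+
qed

section \<open>Subgroups generated by powers\<close>

definition power_subgroup :: "('a, 'b) monoid_scheme \<Rightarrow> nat \<Rightarrow> 'a set" where
  "power_subgroup G m = generate G {x [^]\<^bsub>G\<^esub> m | x. x \<in> carrier G}"

lemma (in group) pow_in_power_subgroup: "x \<in> carrier G \<Longrightarrow> x [^] m \<in> power_subgroup G m"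
  unfolding power_subgroup_def by (blast intro: generate.incl)

text \<open>Homomorphisms send \<open>m\<close>-th powers to \<open>m\<close>-th powers. Applied
  below to automorphisms, to the inclusion of a free factor and to the retraction onto it.\<close>

lemma (in group_hom) hom_power_subgroup:
  assumes "x \<in> power_subgroup G m"
  shows "h x \<in> power_subgroup H m"
proof -
  have "h ` power_subgroup G m = generate H (h ` {x [^] m | x. x \<in> carrier G})"
    unfolding power_subgroup_def by (intro generate_img[symmetric]) auto
  also have "\<dots> \<subseteq> power_subgroup H m"
    unfolding power_subgroup_def by (intro H.mono_generate) (auto simp: hom_nat_pow)
  finally show ?thesis using assms by auto
qed

lemma (in group) power_subgroup_normal: "power_subgroup G m \<lhd> G"
  unfolding power_subgroup_def
proof (rule normal_generateI)
  fix h g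
  assume "h \<in> {x [^] m |x. x \<in> carrier G}" and g: "g \<in> carrier G"
  then obtain x where x: "x \<in> carrier G" "h = x [^] m" by blast
  \<comment> \<open>Conjugation by \<open>g\<close> is an endomorphism, so it turns the power of
    \<open>x\<close> into the power of the conjugate of \<open>x\<close>.\<close>
  interpret c: group_hom G G "\<lambda>x. g \<otimes> x \<otimes> inv g"
  proof unfold_locales
    have "inv g \<otimes> (g \<otimes> y) = y" if "y \<in> carrier G" for y
      using g that by (simp flip: m_assoc)
    then show "(\<lambda>x. g \<otimes> x \<otimes> inv g) \<in> hom G G"
      using g by (auto simp: hom_def m_assoc)
  qed
  have "g \<otimes> h \<otimes> inv g = (g \<otimes> x \<otimes> inv g) [^] m"
    using x c.hom_nat_pow by simp
  then show "g \<otimes> h \<otimes> inv g \<in> {x [^] m |x. x \<in> carrier G}"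
    using x g by auto
qed auto

section \<open>Cosets and normal closures\<close>

lemma (in normal) rcos_eq_iff:
  assumes "x \<in> carrier G" "y \<in> carrier G"
  shows "H #> x = H #> y \<longleftrightarrow> x \<otimes> inv y \<in> H"
proof -
  have "H #> x = H #> y \<longleftrightarrow> x \<in> H #> y"
    using assms subgroup_axioms by (metis rcos_self repr_independence)
  then show ?thesis
    using assms is_group by (simp add: rcos_module)
qed

lemma normal_closure_normal:
  assumes "group G" "R \<subseteq> carrier G"
  shows "normal_closure G R \<lhd> G"
proof -
  interpret group G by fact
  show ?thesis
    unfolding normal_inv_iff
  proof
    show "subgroup (normal_closure G R) G"
      unfolding normal_closure_def
      \<comment> \<open>As \<open>R\<close> lies in the carrier, the whole group is a member of the
        family, so the intersection is not an empty one.\<close>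
      using normal_self assms(2) by (intro subgroups_Inter) (auto dest: normal_imp_subgroup)
    show "\<forall>x\<in>carrier G. \<forall>h\<in>normal_closure G R. x \<otimes>\<^bsub>G\<^esub> h \<otimes>\<^bsub>G\<^esub> inv\<^bsub>G\<^esub> x \<in> normal_closure G R"
      by (auto simp: normal_closure_def dest: normal.inv_op_closed2)
  qed
qed

lemma normal_closure_minimal: "N \<lhd> G \<Longrightarrow> R \<subseteq> N \<Longrightarrow> normal_closure G R \<subseteq> N"
  by (auto simp: normal_closure_def)

section \<open>Automorphisms that are trivial modulo powers\<close>

lemma carrier_AutoGroup: "carrier (AutoGroup G) = auto G"
  by (simp add: AutoGroup_def)

lemma autoD:
  assumes "f \<in> auto G"
  shows auto_hom: "f \<in> hom G G" and auto_Bij: "f \<in> Bij (carrier G)"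
  using assms by (auto simp: auto_def)

lemma auto_closed: "f \<in> auto G \<Longrightarrow> x \<in> carrier G \<Longrightarrow> f x \<in> carrier G"
  by (auto simp: auto_def hom_def)

lemma AutoGroup_mult_apply:
  assumes "f \<in> auto G" "g \<in> auto G" "x \<in> carrier G"
  shows "(f \<otimes>\<^bsub>AutoGroup G\<^esub> g) x = f (g x)"
  using assms by (simp add: AutoGroup_def BijGroup_def auto_Bij compose_def)

lemma AutoGroup_one_apply: "x \<in> carrier G \<Longrightarrow> \<one>\<^bsub>AutoGroup G\<^esub> x = x"
  by (simp add: AutoGroup_def BijGroup_def)

lemma auto_eqI:
  assumes "f \<in> auto G" "g \<in> auto G" "\<And>x. x \<in> carrier G \<Longrightarrow> f x = g x"
  shows "f = g"
  using assms by (intro extensionalityI[of f "carrier G" g]) (auto simp: auto_def Bij_def)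

text \<open>The kernel of the action of Aut(G) on \<open>G\<close> modulo its power subgroup,
  phrased with cosets so that induced automorphisms need not be constructed.\<close>

definition autos_trivial_mod_powers :: "('a, 'b) monoid_scheme \<Rightarrow> nat \<Rightarrow> ('a \<Rightarrow> 'a) set" where
  "autos_trivial_mod_powers G m =
     {f \<in> auto G. \<forall>x\<in>carrier G. power_subgroup G m #>\<^bsub>G\<^esub> f x = power_subgroup G m #>\<^bsub>G\<^esub> x}"

lemma (in group) auto_power_coset_cong:
  assumes f: "f \<in> auto G" and xy: "x \<in> carrier G" "y \<in> carrier G"
    and eq: "power_subgroup G m #> x = power_subgroup G m #> y"
  shows "power_subgroup G m #> f x = power_subgroup G m #> f y"
proof -
  interpret V: normal "power_subgroup G m" G by (rule power_subgroup_normal)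
  interpret f: group_hom G G f
    using auto_hom[OF f] by unfold_locales
  show ?thesis
    using f.hom_power_subgroup[of "x \<otimes> inv y" m] eq xy by (simp add: V.rcos_eq_iff)
qed

lemma (in group) autos_trivial_mod_powers_normal:
  "autos_trivial_mod_powers G m \<lhd> AutoGroup G"
proof -
  interpret A: group "AutoGroup G" by (rule AutoGroup)
  let ?K = "autos_trivial_mod_powers G m"
  let ?p = "\<lambda>x. power_subgroup G m #> x"
  have inv_auto: "inv\<^bsub>AutoGroup G\<^esub> f \<in> auto G" if "f \<in> auto G" for f
    using that A.inv_closed by (simp add: carrier_AutoGroup)
  have inv_apply: "f ((inv\<^bsub>AutoGroup G\<^esub> f) x) = x" "(inv\<^bsub>AutoGroup G\<^esub> f) (f x) = x"
    if "f \<in> auto G" "x \<in> carrier G" for f x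
    using that inv_auto A.r_inv[of f] A.l_inv[of f]
    by (metis carrier_AutoGroup AutoGroup_one_apply AutoGroup_mult_apply)+
  have mult_auto: "f \<otimes>\<^bsub>AutoGroup G\<^esub> g \<in> auto G" if "f \<in> auto G" "g \<in> auto G" for f g
    using that A.m_closed by (simp add: carrier_AutoGroup)
  show ?thesis
    unfolding A.normal_inv_iff
  proof (intro conjI ballI A.subgroupI)
    show "?K \<subseteq> carrier (AutoGroup G)"
      by (auto simp: autos_trivial_mod_powers_def carrier_AutoGroup)
    have "\<one>\<^bsub>AutoGroup G\<^esub> \<in> ?K"
      using A.one_closed
      by (auto simp: autos_trivial_mod_powers_def carrier_AutoGroup AutoGroup_one_apply)
    then show "?K \<noteq> {}" by blast
  next
    fix f assume f: "f \<in> ?K"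
    then have fa: "f \<in> auto G" by (simp add: autos_trivial_mod_powers_def)
    have "?p ((inv\<^bsub>AutoGroup G\<^esub> f) x) = ?p x" if "x \<in> carrier G" for x
      using f that auto_closed[OF inv_auto[OF fa] that] inv_apply(1)[OF fa that]
      by (fastforce simp: autos_trivial_mod_powers_def)
    then show "inv\<^bsub>AutoGroup G\<^esub> f \<in> ?K"
      using inv_auto[OF fa] by (simp add: autos_trivial_mod_powers_def)
  next
    fix f g assume "f \<in> ?K" "g \<in> ?K"
    then show "f \<otimes>\<^bsub>AutoGroup G\<^esub> g \<in> ?K"
      by (simp add: autos_trivial_mod_powers_def mult_auto AutoGroup_mult_apply auto_closed)
  next
    fix g f assume g: "g \<in> carrier (AutoGroup G)" and f: "f \<in> ?K"
    have ga: "g \<in> auto G" and fa: "f \<in> auto G"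
      using f g by (simp_all add: carrier_AutoGroup autos_trivial_mod_powers_def)
    have "?p (g (f ((inv\<^bsub>AutoGroup G\<^esub> g) x))) = ?p x" if x: "x \<in> carrier G" for x
    proof -
      \<comment> \<open>\<open>f\<close> preserves the coset of \<open>?y\<close>, \<open>g\<close>
        respects equality of cosets, and \<open>g\<close> maps \<open>?y\<close> back to
        \<open>x\<close>.\<close>
      let ?y = "(inv\<^bsub>AutoGroup G\<^esub> g) x"
      have y: "?y \<in> carrier G"
        using auto_closed[OF inv_auto[OF ga] x] .
      then have "?p (f ?y) = ?p ?y"
        using f by (simp add: autos_trivial_mod_powers_def)
      then have "?p (g (f ?y)) = ?p (g ?y)"
        using y auto_closed[OF fa y] by (intro auto_power_coset_cong[OF ga])
      then show ?thesis
        using inv_apply(1)[OF ga x] by simp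
    qed
    then show "g \<otimes>\<^bsub>AutoGroup G\<^esub> f \<otimes>\<^bsub>AutoGroup G\<^esub> inv\<^bsub>AutoGroup G\<^esub> g \<in> ?K"
      using ga fa inv_auto[OF ga]
      by (simp add: autos_trivial_mod_powers_def mult_auto AutoGroup_mult_apply auto_closed)
  qed
qed

section \<open>Transvections\<close>

text \<open>For \<open>i\<close> in \<open>S\<close>, classes over \<open>S - {i}\<close> lack the
  words in which \<open>i\<close> occurs, so the smaller free group is not literally a subgroup and
  has to be embedded.\<close>

definition basis_incl :: "'a set \<Rightarrow> 'a \<Rightarrow> 'a word set \<Rightarrow> 'a word set" where
  "basis_incl S i = free_ext (free_group S) (S - {i}) (basis_elem S)"

text \<open>
  The inverse makes \<open>w \<mapsto> transvection S i w\<close> a homomorphism: composing the substitutions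
  \<open>a\<^sub>i \<mapsto> v a\<^sub>i\<close> and \<open>a\<^sub>i \<mapsto> w a\<^sub>i\<close> multiplies \<open>v\<close> and \<open>w\<close> in the opposite order.
\<close>

definition transvection :: "'a set \<Rightarrow> 'a \<Rightarrow> 'a word set \<Rightarrow> 'a word set \<Rightarrow> 'a word set" where
  "transvection S i w = restrict
     (free_ext (free_group S) S
        (\<lambda>k. if k = i then inv\<^bsub>free_group S\<^esub> (basis_incl S i w) \<otimes>\<^bsub>free_group S\<^esub> basis_elem S i
             else basis_elem S k))
     (carrier (free_group S))"

context
  fixes S :: "'a set" and i :: 'a
  assumes i: "i \<in> S"
begin

interpretation F: group "free_group S" by (rule group_free_group)
interpretation T: group "free_group (S - {i})" by (rule group_free_group)

lemma basis_incl_hom: "basis_incl S i \<in> hom (free_group (S - {i})) (free_group S)"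
  unfolding basis_incl_def by (rule F.free_ext_hom) auto

interpretation incl: group_hom "free_group (S - {i})" "free_group S" "basis_incl S i"
  using basis_incl_hom by unfold_locales

lemma basis_incl_basis: "x \<in> S - {i} \<Longrightarrow> basis_incl S i (basis_elem (S - {i}) x) = basis_elem S x"
  unfolding basis_incl_def by (rule F.free_ext_basis) auto

lemma basis_incl_in_power_subgroup_iff:
  assumes "w \<in> carrier (free_group (S - {i}))"
  shows "basis_incl S i w \<in> power_subgroup (free_group S) m \<longleftrightarrow>
         w \<in> power_subgroup (free_group (S - {i})) m"
proof
  \<comment> \<open>\<open>r\<close> kills the generator \<open>i\<close> and is a left inverse of
    \<open>basis_incl S i\<close>, so it brings membership in the power subgroup back to the smaller
    group.\<close>
  let ?g = "\<lambda>k. if k = i then \<one>\<^bsub>free_group (S - {i})\<^esub> else basis_elem (S - {i}) k"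
  define r where "r = free_ext (free_group (S - {i})) S ?g"
  have g: "?g \<in> S \<rightarrow> carrier (free_group (S - {i}))" by auto
  interpret r: group_hom "free_group S" "free_group (S - {i})" r
    unfolding r_def using T.free_ext_hom[OF g] by unfold_locales
  have "(r \<circ> basis_incl S i) w = (\<lambda>x. x) w"
  proof (rule T.free_group_hom_eqI[OF _ _ _ assms])
    show "r \<circ> basis_incl S i \<in> hom (free_group (S - {i})) (free_group (S - {i}))"
      by (rule hom_compose[OF basis_incl_hom r.homh])
    show "(\<lambda>x. x) \<in> hom (free_group (S - {i})) (free_group (S - {i}))"
      by (auto simp: hom_def)
    show "(r \<circ> basis_incl S i) (basis_elem (S - {i}) x) = basis_elem (S - {i}) x"
      if "x \<in> S - {i}" for x
      using that by (auto simp: basis_incl_basis r_def T.free_ext_basis[OF g])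
  qed
  moreover assume "basis_incl S i w \<in> power_subgroup (free_group S) m"
  ultimately show "w \<in> power_subgroup (free_group (S - {i})) m"
    using r.hom_power_subgroup by fastforce
qed (rule incl.hom_power_subgroup)

context
  fixes w
  assumes w: "w \<in> carrier (free_group (S - {i}))"
begin

lemma transvection_hom: "transvection S i w \<in> hom (free_group S) (free_group S)"
  unfolding transvection_def
  by (rule F.hom_restrict[OF F.free_ext_hom]) (use w i in auto)

lemma transvection_basis:
  "k \<in> S \<Longrightarrow> transvection S i w (basis_elem S k) =
    (if k = i then inv\<^bsub>free_group S\<^esub> (basis_incl S i w) \<otimes>\<^bsub>free_group S\<^esub> basis_elem S i
     else basis_elem S k)"
  unfolding transvection_def using w i
  by (simp add: F.free_ext_basis Pi_iff)

text \<open>This makes composites computable: a transvection applied to v^-1 a_i changes only the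
  factor a_i.\<close>

lemma transvection_basis_incl:
  assumes "v \<in> carrier (free_group (S - {i}))"
  shows "transvection S i w (basis_incl S i v) = basis_incl S i v"
proof -
  have "(transvection S i w \<circ> basis_incl S i) v = basis_incl S i v"
    by (rule F.free_group_hom_eqI[OF hom_compose[OF basis_incl_hom transvection_hom]
          basis_incl_hom _ assms])
       (auto simp: basis_incl_basis transvection_basis)
  then show ?thesis by simp
qed

end

text \<open>The decisive basis element is a_i, which the right-hand side sends first to v^-1 a_i and
  then to v^-1 w^-1 a_i = (w v)^-1 a_i.\<close>

lemma transvection_mult:
  assumes w: "w \<in> carrier (free_group (S - {i}))" and v: "v \<in> carrier (free_group (S - {i}))"
    and x: "x \<in> carrier (free_group S)"
  shows "transvection S i (w \<otimes>\<^bsub>free_group (S - {i})\<^esub> v) x = transvection S i w (transvection S i v x)"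
proof -
  interpret t: group_hom "free_group S" "free_group S" "transvection S i w"
    using transvection_hom[OF w] by unfold_locales
  have "transvection S i (w \<otimes>\<^bsub>free_group (S - {i})\<^esub> v) x =
        (transvection S i w \<circ> transvection S i v) x"
  proof (rule F.free_group_hom_eqI[OF _ _ _ x])
    show "transvection S i (w \<otimes>\<^bsub>free_group (S - {i})\<^esub> v) \<in> hom (free_group S) (free_group S)"
      using w v by (intro transvection_hom) simp
    show "transvection S i w \<circ> transvection S i v \<in> hom (free_group S) (free_group S)"
      by (rule hom_compose[OF transvection_hom[OF v] transvection_hom[OF w]])
    show "transvection S i (w \<otimes>\<^bsub>free_group (S - {i})\<^esub> v) (basis_elem S k) =
          (transvection S i w \<circ> transvection S i v) (basis_elem S k)" if "k \<in> S" for k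
      using that w v i
      by (auto simp: transvection_basis transvection_basis_incl F.inv_mult_group F.m_assoc)
  qed
  then show ?thesis by simp
qed

lemma transvection_one:
  assumes x: "x \<in> carrier (free_group S)"
  shows "transvection S i \<one>\<^bsub>free_group (S - {i})\<^esub> x = x"
proof -
  have "transvection S i \<one>\<^bsub>free_group (S - {i})\<^esub> x = (\<lambda>x. x) x"
    by (rule F.free_group_hom_eqI[OF transvection_hom _ _ x])
       (auto simp: hom_def transvection_basis i)
  then show ?thesis by simp
qed

text \<open>The inverse map is the transvection by w^-1, because \<open>transvection_mult\<close>
  merges the composites into the transvection by the identity.\<close>

lemma transvection_auto:
  assumes w: "w \<in> carrier (free_group (S - {i}))"
  shows "transvection S i w \<in> auto (free_group S)"
proof -
  let ?w' = "inv\<^bsub>free_group (S - {i})\<^esub> w"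
  have "bij_betw (transvection S i w) (carrier (free_group S)) (carrier (free_group S))"
  proof (rule bij_betw_byWitness[where f' = "transvection S i ?w'"])
    show "transvection S i w ` carrier (free_group S) \<subseteq> carrier (free_group S)"
      "transvection S i ?w' ` carrier (free_group S) \<subseteq> carrier (free_group S)"
      using transvection_hom[OF w] transvection_hom[of ?w'] w by (auto simp: hom_def)
  qed (use w in \<open>simp_all add: transvection_one flip: transvection_mult\<close>)
  \<comment> \<open>\<open>Bij\<close> demands extensional maps; the \<open>restrict\<close> in
    \<open>transvection\<close> provides this.\<close>
  then show ?thesis
    using transvection_hom[OF w] by (simp add: auto_def Bij_def transvection_def)
qed

lemma transvection_hom_AutoGroup:
  "transvection S i \<in> hom (free_group (S - {i})) (AutoGroup (free_group S))"
proof (rule homI)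
  interpret A: group "AutoGroup (free_group S)" by (rule F.AutoGroup)
  fix w v
  assume wv: "w \<in> carrier (free_group (S - {i}))" "v \<in> carrier (free_group (S - {i}))"
  show "transvection S i (w \<otimes>\<^bsub>free_group (S - {i})\<^esub> v) =
        transvection S i w \<otimes>\<^bsub>AutoGroup (free_group S)\<^esub> transvection S i v"
    using wv A.m_closed[of "transvection S i w" "transvection S i v"]
    by (intro auto_eqI[of _ "free_group S"])
       (simp_all add: transvection_auto carrier_AutoGroup AutoGroup_mult_apply transvection_mult)
qed (simp add: carrier_AutoGroup transvection_auto)

lemma transvection_inv_basis:
  assumes "j \<in> S - {i}" "k \<in> S"
  shows "transvection S i (inv\<^bsub>free_group (S - {i})\<^esub> basis_elem (S - {i}) j) (basis_elem S k) =
    (if k = i then basis_elem S j \<otimes>\<^bsub>free_group S\<^esub> basis_elem S i else basis_elem S k)"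
  using assms by (simp add: transvection_basis basis_incl_basis)

text \<open>Modulo powers, w^-1 a_i and a_i agree iff the image of \<open>w\<close> is trivial, and
  all other basis elements are fixed. The retraction then moves the condition to the smaller free
  group.\<close>

lemma transvection_trivial_mod_powers_iff:
  assumes w: "w \<in> carrier (free_group (S - {i}))"
  shows "transvection S i w \<in> autos_trivial_mod_powers (free_group S) m \<longleftrightarrow>
         w \<in> power_subgroup (free_group (S - {i})) m"
proof -
  define V where "V = power_subgroup (free_group S) m"
  interpret V: normal V "free_group S"
    unfolding V_def by (rule F.power_subgroup_normal)
  have closed: "basis_incl S i w \<in> carrier (free_group S)"
    using w by simp
  have basis_i: "V #>\<^bsub>free_group S\<^esub> transvection S i w (basis_elem S i) =
      V #>\<^bsub>free_group S\<^esub> basis_elem S i \<longleftrightarrow> basis_incl S i w \<in> V"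
  proof -
    have "inv\<^bsub>free_group S\<^esub> basis_incl S i w \<in> V \<longleftrightarrow> basis_incl S i w \<in> V"
      using closed by (metis F.inv_inv V.m_inv_closed)
    then show ?thesis
      using i closed by (simp add: transvection_basis[OF w] V.rcos_eq_iff F.m_assoc)
  qed
  have "V #>\<^bsub>free_group S\<^esub> transvection S i w x = V #>\<^bsub>free_group S\<^esub> x"
    if "basis_incl S i w \<in> V" and x: "x \<in> carrier (free_group S)" for x
  proof -
    have basis: "V #>\<^bsub>free_group S\<^esub> transvection S i w (basis_elem S k) = V #>\<^bsub>free_group S\<^esub> basis_elem S k"
      if "k \<in> S" for k
      using that \<open>basis_incl S i w \<in> V\<close> basis_i by (cases "k = i") (simp_all add: transvection_basis[OF w])
    \<comment> \<open>Both sides are homomorphisms into the quotient by \<open>V\<close>, so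
      agreement on the basis is enough.\<close>
    have "((\<lambda>x. V #>\<^bsub>free_group S\<^esub> x) \<circ> transvection S i w) x = V #>\<^bsub>free_group S\<^esub> x"
      by (rule group.free_group_hom_eqI[OF V.factorgroup_is_group
            hom_compose[OF transvection_hom[OF w] V.r_coset_hom_Mod] V.r_coset_hom_Mod _ x])
         (use basis in simp)
    then show ?thesis by simp
  qed
  then have "transvection S i w \<in> autos_trivial_mod_powers (free_group S) m \<longleftrightarrow> basis_incl S i w \<in> V"
    using basis_i i by (auto simp: autos_trivial_mod_powers_def transvection_auto[OF w] simp flip: V_def)
  then show ?thesis
    unfolding V_def using basis_incl_in_power_subgroup_iff[OF w] by simp
qed

end

section \<open>The quotient of the automorphism group\<close>

text \<open>Taking w = a_j^-1 cancels the inverse built into \<open>transvection\<close>. Uniqueness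
  holds since basis values determine a homomorphism on the carrier and automorphisms are
  extensional.\<close>

lemma lam_eq_transvection:
  assumes "i \<in> {1..n}" "j \<in> {1..n}" "i \<noteq> j"
  shows "lam n i j =
    transvection {1..n} i (inv\<^bsub>free_group ({1..n} - {i})\<^esub> basis_elem ({1..n} - {i}) j)"
proof -
  interpret F: group "Fn n" by (rule group_free_group)
  interpret T: group "free_group ({1..n} - {i})" by (rule group_free_group)
  let ?t = "transvection {1..n} i (inv\<^bsub>free_group ({1..n} - {i})\<^esub> basis_elem ({1..n} - {i}) j)"
  have j: "basis_elem ({1..n} - {i}) j \<in> carrier (free_group ({1..n} - {i}))"
    using assms by simp
  have auto: "?t \<in> auto (Fn n)"
    using assms(1) T.inv_closed[OF j] by (rule transvection_auto)
  have basis: "?t (gen n k) = (if k = i then gen n j \<otimes>\<^bsub>Fn n\<^esub> gen n i else gen n k)"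
    if "k \<in> {1..n}" for k
    using that assms by (intro transvection_inv_basis) auto
  show ?thesis
    unfolding lam_def
  proof (rule the_equality)
    fix f assume f: "f \<in> auto (Fn n) \<and> f (gen n i) = gen n j \<otimes>\<^bsub>Fn n\<^esub> gen n i \<and>
      (\<forall>k\<in>{1..n} - {i}. f (gen n k) = gen n k)"
    show "f = ?t"
    proof (rule auto_eqI)
      show "f x = ?t x" if "x \<in> carrier (Fn n)" for x
        using f basis by (intro F.free_group_hom_eqI[OF auto_hom auto_hom[OF auto] _ that]) auto
    qed (use f auto in auto)
  qed (use assms auto basis in auto)
qed

text \<open>By the homomorphism property, the power of \<open>lam n i j\<close> is the transvection
  by the \<open>m\<close>-th power of a_j^-1.\<close>

lemma lam_pow_trivial_mod_powers:
  assumes "i \<in> {1..n}" "j \<in> {1..n}" "i \<noteq> j"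
  shows "lam n i j [^]\<^bsub>AutoGroup (Fn n)\<^esub> m \<in> autos_trivial_mod_powers (Fn n) m"
proof -
  interpret F: group "Fn n" by (rule group_free_group)
  interpret T: group "free_group ({1..n} - {i})" by (rule group_free_group)
  interpret t: group_hom "free_group ({1..n} - {i})" "AutoGroup (Fn n)" "transvection {1..n} i"
    using transvection_hom_AutoGroup[OF assms(1)] F.AutoGroup T.is_group
    by (simp add: group_hom_def group_hom_axioms_def)
  let ?w = "inv\<^bsub>free_group ({1..n} - {i})\<^esub> basis_elem ({1..n} - {i}) j"
  have w: "?w \<in> carrier (free_group ({1..n} - {i}))"
    using assms by (intro T.inv_closed basis_elem_closed) auto
  have "transvection {1..n} i (?w [^]\<^bsub>free_group ({1..n} - {i})\<^esub> m) \<in> autos_trivial_mod_powers (Fn n) m"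
    using transvection_trivial_mod_powers_iff[OF assms(1) T.nat_pow_closed[OF w]]
      T.pow_in_power_subgroup[OF w] by blast
  then show ?thesis
    unfolding lam_eq_transvection[OF assms] t.hom_nat_pow[OF w] .
qed

theorem propositionF:
  fixes n m :: nat
  assumes "n \<ge> 3" and "m \<ge> 1"
  shows "\<exists>(G :: free_aut set set monoid) f H.
           group G \<and> f \<in> epi (Q_group n m) G \<and>
           subgroup H G \<and> G\<lparr>carrier := H\<rparr> \<cong> free_burnside (n - 1) m"
proof -
  interpret F: group "Fn n" by (rule group_free_group)
  interpret T: group "Fn (n - 1)" by (rule group_free_group)
  let ?A = "AutoGroup (Fn n)"
  interpret A: group ?A by (rule F.AutoGroup)
  define K where "K = autos_trivial_mod_powers (Fn n) m"
  interpret K: normal K ?A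
    unfolding K_def by (rule F.autos_trivial_mod_powers_normal)
  define R where "R = {lam n i j [^]\<^bsub>?A\<^esub> m | i j. i \<in> {1..n} \<and> j \<in> {1..n} \<and> i \<noteq> j}"
  have RK: "R \<subseteq> K"
    unfolding R_def K_def using lam_pow_trivial_mod_powers by blast
  define N where "N = normal_closure ?A R"
  interpret N: normal N ?A
    unfolding N_def using RK K.subset by (intro normal_closure_normal A.is_group) blast
  have NK: "N \<subseteq> K"
    unfolding N_def by (rule normal_closure_minimal[OF K.normal_axioms RK])
  have Q: "Q_group n m = ?A Mod N"
    by (simp add: Q_group_def N_def R_def)
  interpret AK: group "?A Mod K" by (rule K.factorgroup_is_group)
  interpret Q: group "?A Mod N" by (rule N.factorgroup_is_group)
  interpret pK: group_hom ?A "?A Mod K" "\<lambda>a. K #>\<^bsub>?A\<^esub> a"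
    using K.r_coset_hom_Mod by unfold_locales
  have coset_K: "K #>\<^bsub>?A\<^esub> a = K \<longleftrightarrow> a \<in> K" if "a \<in> carrier ?A" for a
    using that K.is_subgroup A.coset_join1 A.coset_join2 K.subset by metis
  \<comment> \<open>The projection modulo \<open>K\<close> kills \<open>N\<close>, so it factors
    through \<open>Q_group n m\<close> as \<open>g\<close>.\<close>
  have "N \<subseteq> kernel ?A (?A Mod K) (\<lambda>a. K #>\<^bsub>?A\<^esub> a)"
    using NK K.subset coset_K by (auto simp: kernel_def)
  from pK.FactGroup_universal_kernel[OF N.normal_axioms this]
  obtain g where g: "g \<in> hom (?A Mod N) (?A Mod K)"
    and g_eq: "\<And>a. a \<in> carrier ?A \<Longrightarrow> g (N #>\<^bsub>?A\<^esub> a) = K #>\<^bsub>?A\<^esub> a"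
    by blast
  interpret g: group_hom "?A Mod N" "?A Mod K" g
    using g by unfold_locales
  \<comment> \<open>\<open>L\<close> is the image of \<open>K\<close> in
    \<open>Q_group n m\<close>.\<close>
  define L where "L = kernel (?A Mod N) (?A Mod K) g"
  interpret L: normal L "?A Mod N"
    unfolding L_def by (rule g.normal_kernel)
  \<comment> \<open>isomorphic to \<open>?A Mod K\<close>, but of the type required of \<open>G\<close>\<close>
  let ?G = "(?A Mod N) Mod L"
  let ?f = "\<lambda>c. L #>\<^bsub>?A Mod N\<^esub> c"
  interpret G: group ?G by (rule L.factorgroup_is_group)
  have epi: "?f \<in> epi (Q_group n m) ?G"
    using L.r_coset_hom_Mod by (simp add: Q epi_def carrier_FactGroup)

  \<comment> \<open>Singling out the last generator makes the free group on the others literally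
    \<open>Fn (n - 1)\<close>, with no relabelling.\<close>
  have n: "n \<in> {1..n}" and T: "{1..n} - {n} = {1..n - 1}"
    using assms by auto
  note tau_hom = transvection_hom_AutoGroup[OF n, unfolded T]
  define h where "h = ?f \<circ> ((\<lambda>a. N #>\<^bsub>?A\<^esub> a) \<circ> transvection {1..n} n)"
  interpret h: group_hom "Fn (n - 1)" ?G h
    unfolding h_def using hom_compose[OF hom_compose[OF tau_hom N.r_coset_hom_Mod] L.r_coset_hom_Mod]
    by unfold_locales
  have "h w = \<one>\<^bsub>?G\<^esub> \<longleftrightarrow> w \<in> power_subgroup (Fn (n - 1)) m" if w: "w \<in> carrier (Fn (n - 1))" for w
  proof -
    have t: "transvection {1..n} n w \<in> carrier ?A"
      using tau_hom w by (auto simp: hom_def)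
    then have c: "N #>\<^bsub>?A\<^esub> transvection {1..n} n w \<in> carrier (?A Mod N)"
      by (simp add: carrier_FactGroup)
    have "h w = \<one>\<^bsub>?G\<^esub> \<longleftrightarrow> N #>\<^bsub>?A\<^esub> transvection {1..n} n w \<in> L"
      using Q.coset_join1[OF _ c L.is_subgroup] Q.coset_join2[OF c L.is_subgroup]
      by (auto simp: h_def)
    also have "\<dots> \<longleftrightarrow> transvection {1..n} n w \<in> K"
      using c g_eq[OF t] coset_K[OF t] by (simp add: L_def kernel_def)
    also have "\<dots> \<longleftrightarrow> w \<in> power_subgroup (Fn (n - 1)) m"
      unfolding K_def using transvection_trivial_mod_powers_iff[OF n, unfolded T, OF w] .
    finally show ?thesis .
  qed
  then have kernel_h: "kernel (Fn (n - 1)) ?G h = power_subgroup (Fn (n - 1)) m"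
    using normal_imp_subgroup[OF T.power_subgroup_normal, THEN subgroup.subset]
    by (auto simp: kernel_def)
  define H where "H = h ` carrier (Fn (n - 1))"
  have H: "subgroup H ?G"
    unfolding H_def by (rule h.img_is_subgroup)
  \<comment> \<open>Shrinking the codomain to the image makes \<open>h\<close> surjective and keeps
    the identity element, hence the kernel.\<close>
  interpret h': group_hom "Fn (n - 1)" "?G\<lparr>carrier := H\<rparr>" h
    using G.subgroup_imp_group[OF H] T.is_group h.homh
    by (simp add: group_hom_def group_hom_axioms_def hom_def H_def)
  have "Fn (n - 1) Mod kernel (Fn (n - 1)) (?G\<lparr>carrier := H\<rparr>) h \<cong> ?G\<lparr>carrier := H\<rparr>"
    by (rule h'.FactGroup_iso) (simp add: H_def)
  then have "free_burnside (n - 1) m \<cong> ?G\<lparr>carrier := H\<rparr>"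
    using kernel_h by (simp add: free_burnside_def power_subgroup_def kernel_def)
  moreover have "group (free_burnside (n - 1) m)"
    using normal.factorgroup_is_group[OF T.power_subgroup_normal]
    by (simp add: free_burnside_def power_subgroup_def)
  ultimately have "?G\<lparr>carrier := H\<rparr> \<cong> free_burnside (n - 1) m"
    by (rule group.iso_sym[rotated])
  then show ?thesis
    using G.is_group epi H by blast
qed

end
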